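(* Let $\xi$ be a random variable with symmetric distribution whose tail function satisfies $T(x)=T_\xi(x)=x^{-r}\log^{\gamma}(x)\,L(\log x)$ for $x>e$, where $r\in(0,2)$, $\gamma\in\mathbb{R}$ and $L$ is a positive continuous function slowly varying at $\infty$. If the distribution of $\xi$ belongs to $RT\cap MD$ (classes defined in the context), then there are constants $C(r,L)\in(0,\infty)$ and $x_0>1$ such that $$T(x)\le U(x)\le C(r,L)\,T(x),\qquad x>x_0.$$
   Context: For a random variable $\eta$ the tail function is $T_\eta(x)=\mathbf{P}(|\eta|\ge x)$, $x>0$, and $\psi_\eta(t)=1-\mathrm{Re}\,\mathbf{E}e^{it\eta}$. Write $\psi=\psi_\xi$. Let $\xi(k)$, $k=1,2,\dots$, be independent copies of $\xi$. The natural norming sequence $b(n)$ is defined by $b(1)=1$ and, for $n=2,3,\dots$, $b(n)$ is a positive solution of $n\,\psi(1/b(n))=1$ (for all sufficiently large $n$ the solution exists and is unique, and $b(n)\to\infty$). Set $S(n)=b(n)^{-1}\sum_{k=1}^n\xi(k)$ and $U(x)=\sup_{n\ge1}T_{S(n)}(x)$. Class $RT$ (regular tail): the law of $\eta$ belongs to $RT$ if there is a constant $C_1>0$ such that for all sufficiently small $a>0$, $T_\eta(2/a)\ge C_1a^{-1}\int_{-a}^a\psi_\eta(t)\,dt$. Class $MD$: the law of $\xi$ belongs to $MD$ if there is $\Delta>0$ such that for every $t\in[0,\Delta)$ the function $\lambda\mapsto\psi(\lambda t)/\psi(\lambda)$ is non-decreasing in $\lambda\in(0,1)$ (i.e. it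 decreases as $\lambda$ decreases to $0$).
   Formalization: The constant C(r,L) is allowed to depend on the whole law of ξ (and on b(n)), not only on r and L; a constant depending on r, γ, L alone is impossible, since mass concentrated near 0 makes b(2) arbitrarily small without changing r, γ or L. *)

theory Defs
  imports "HOL-Probability.Probability"
begin

definition tail_fun :: "'a measure \<Rightarrow> ('a \<Rightarrow> real) \<Rightarrow> real \<Rightarrow> real" where
  "tail_fun M \<eta> x = measure M {\<omega> \<in> space M. \<bar>\<eta> \<omega>\<bar> \<ge> x}"

definition psi :: "'a measure \<Rightarrow> ('a \<Rightarrow> real) \<Rightarrow> real \<Rightarrow> real" where
  "psi M \<eta> t = 1 - Re (char (distr M borel \<eta>) t)"

definition symmetric_rv :: "'a measure \<Rightarrow> ('a \<Rightarrow> real) \<Rightarrow> bool" where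
  "symmetric_rv M \<eta> \<longleftrightarrow> distr M borel (\<lambda>\<omega>. - \<eta> \<omega>) = distr M borel \<eta>"

definition class_RT :: "'a measure \<Rightarrow> ('a \<Rightarrow> real) \<Rightarrow> bool" where
  "class_RT M \<eta> \<longleftrightarrow>
     (\<exists>C1>0. \<forall>\<^sub>F a in at_right 0.
        tail_fun M \<eta> (2 / a) \<ge> C1 * inverse a * (LBINT t:{-a..a}. psi M \<eta> t))"

definition class_MD :: "'a measure \<Rightarrow> ('a \<Rightarrow> real) \<Rightarrow> bool" where
  "class_MD M \<eta> \<longleftrightarrow>
     (\<exists>\<Delta>>0. \<forall>t\<in>{0..<\<Delta>}.
        mono_on {0<..<1} (\<lambda>l. psi M \<eta> (l * t) / psi M \<eta> l))"

(* Positivity and regularity of L are not part of this predicate. *)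
definition slowly_varying :: "(real \<Rightarrow> real) \<Rightarrow> bool" where
  "slowly_varying L \<longleftrightarrow> (\<forall>c>0. ((\<lambda>x. L (c * x) / L x) \<longlongrightarrow> 1) at_top)"

(* For finitely many small n the equation n psi(1/b) = 1 may have no positive solution
   (e.g. if \<xi> has a large atom at 0); there b n is an arbitrary positive number.
   The equation may also have spurious solutions b close to 0, as psi can return to
   values near 0 far from the origin; divergence of b excludes these for large n. *)
definition natural_norming :: "'a measure \<Rightarrow> ('a \<Rightarrow> real) \<Rightarrow> (nat \<Rightarrow> real) \<Rightarrow> bool" where
  "natural_norming M \<xi> b \<longleftrightarrow>
     b 1 = 1 \<and>
     (\<forall>n\<ge>2. b n > 0 \<and>
        ((\<exists>c>0. real n * psi M \<xi> (1 / c) = 1) \<longrightarrow> real n * psi M \<xi> (1 / b n) = 1)) \<and>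
     filterlim b at_top sequentially"

definition iid_copies :: "'a measure \<Rightarrow> ('a \<Rightarrow> real) \<Rightarrow> (nat \<Rightarrow> 'a \<Rightarrow> real) \<Rightarrow> bool" where
  "iid_copies M \<xi> X \<longleftrightarrow>
     prob_space.indep_vars M (\<lambda>_. borel) X {1..} \<and>
     (\<forall>k\<ge>1. distr M borel (X k) = distr M borel \<xi>)"

definition normed_sum :: "(nat \<Rightarrow> real) \<Rightarrow> (nat \<Rightarrow> 'a \<Rightarrow> real) \<Rightarrow> nat \<Rightarrow> 'a \<Rightarrow> real" where
  "normed_sum b X n \<omega> = inverse (b n) * (\<Sum>k=1..n. X k \<omega>)"

definition sup_tail ::
  "'a measure \<Rightarrow> (nat \<Rightarrow> real) \<Rightarrow> (nat \<Rightarrow> 'a \<Rightarrow> real) \<Rightarrow> real \<Rightarrow> real" where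
  "sup_tail M b X x = (SUP n\<in>{1..}. tail_fun M (normed_sum b X n) x)"

end

theory Submission
  imports Defs
begin

text \<open>
  The lower bound is the term \<open>n = 1\<close> of the supremum: since \<open>b 1 = 1\<close>, the normed sum
  \<open>S(1)\<close> is the copy \<open>X 1\<close> of \<open>\<xi>\<close>.

  For the upper bound, tails and the function \<open>\<psi>\<close> near the origin control each other.
  Averaging \<open>1 - cos (t\<eta>)\<close> over \<open>\<bar>t\<bar> \<le> a\<close> gives the classical truncation inequality
  \<open>T\<^sub>\<eta>(2/a) \<le> a\<^sup>-\<^sup>1 \<integral>\<psi>\<^sub>\<eta>\<close> (integral over \<open>[-a, a]\<close>), valid for every random variable;
  the class \<open>RT\<close> supplies the reverse inequality for \<open>\<xi>\<close>, up to a constant and for small \<open>a\<close>.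
  Hence a bound \<open>\<psi>\<^sub>\<eta>(t) \<le> K \<psi>(ct)\<close> near \<open>t = 0\<close>, with any dilation \<open>c > 0\<close>, gives
  \<open>T\<^sub>\<eta> \<le> C T\<^sub>\<xi>\<close> near infinity, with \<open>C\<close> and the threshold depending on \<open>\<eta>\<close> only through
  \<open>K\<close>, \<open>c\<close> and the size of the neighbourhood (lemma \<open>tail_le_if_psi_le\<close>). The dilation costs
  only a constant because \<open>\<psi>(2t) \<le> 4 \<psi>(t)\<close>.

  It remains to bound \<open>\<psi>\<close> of \<open>S(n)\<close>. Symmetry makes the characteristic function of \<open>\<xi>\<close>
  the real number \<open>1 - \<psi>\<close>, so that \<open>\<psi>\<close> of \<open>S(n)\<close> at \<open>t\<close> is
  \<open>1 - (1 - \<psi>(t / b n))\<^sup>n \<le> n \<psi>(t / b n)\<close>. For large \<open>n\<close> the norming equation turns the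
  right-hand side into \<open>\<psi>(\<lambda>t) / \<psi>(\<lambda>)\<close> with \<open>\<lambda> = 1 / b n\<close>, and by the class \<open>MD\<close> this quotient
  does not decrease when \<open>\<lambda>\<close> is raised to a fixed \<open>l < 1\<close>. Choosing \<open>l\<close> with \<open>\<psi>(l) > 0\<close>, one bound
  \<open>\<psi>(lt) / \<psi>(l)\<close> serves all large \<open>n\<close> (lemma \<open>eventually_psi_normed_sum_le\<close>). For each of the
  finitely many other \<open>n\<close>, the bound \<open>n \<psi>(t / b n)\<close> is itself of the required form.
\<close>

section \<open>Elementary properties of \<open>\<psi>\<close>\<close>

lemma psi_eq_integral:
  fixes \<eta> :: "'a \<Rightarrow> real"
  assumes "prob_space M" and [measurable]: "\<eta> \<in> borel_measurable M"
  shows "psi M \<eta> t = (LINT \<omega>|M. 1 - cos (t * \<eta> \<omega>))"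
proof -
  interpret prob_space M by fact
  have int: "complex_integrable M (\<lambda>\<omega>. iexp (t * \<eta> \<omega>))"
    by (rule integrable_const_bound[of _ 1]) auto
  have cos_int: "integrable M (\<lambda>\<omega>. cos (t * \<eta> \<omega>))"
    by (rule integrable_const_bound[of _ 1]) auto
  have "char (distr M borel \<eta>) t = (CLINT \<omega>|M. iexp (t * \<eta> \<omega>))"
    unfolding char_def by (subst integral_distr) auto
  then have "Re (char (distr M borel \<eta>) t) = (LINT \<omega>|M. Re (iexp (t * \<eta> \<omega>)))"
    using int by (simp add: integral_Re)
  also have "\<dots> = (LINT \<omega>|M. cos (t * \<eta> \<omega>))"
    by (simp add: Re_exp)
  finally show ?thesis
    using cos_int by (simp add: psi_def prob_space)
qed

lemma integrable_one_minus_cos: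
  fixes \<eta> :: "'a \<Rightarrow> real"
  assumes "prob_space M" and [measurable]: "\<eta> \<in> borel_measurable M"
  shows "integrable M (\<lambda>\<omega>. 1 - cos (t * \<eta> \<omega>))"
proof -
  interpret prob_space M by fact
  show ?thesis
    by (rule integrable_const_bound[of _ 2]) (auto intro!: AE_I2 simp: abs_le_iff add_increasing)
qed

lemma psi_nonneg:
  fixes \<eta> :: "'a \<Rightarrow> real"
  assumes "prob_space M" "\<eta> \<in> borel_measurable M"
  shows "0 \<le> psi M \<eta> t"
  unfolding psi_eq_integral[OF assms] by (intro Bochner_Integration.integral_nonneg) simp

lemma psi_0:
  fixes \<eta> :: "'a \<Rightarrow> real"
  assumes "prob_space M" "\<eta> \<in> borel_measurable M"
  shows "psi M \<eta> 0 = 0"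
  unfolding psi_eq_integral[OF assms] by simp

lemma psi_minus:
  fixes \<eta> :: "'a \<Rightarrow> real"
  assumes "prob_space M" "\<eta> \<in> borel_measurable M"
  shows "psi M \<eta> (- t) = psi M \<eta> t"
  unfolding psi_eq_integral[OF assms] by simp

lemma continuous_psi:
  fixes \<eta> :: "'a \<Rightarrow> real"
  assumes "prob_space M" "\<eta> \<in> borel_measurable M"
  shows "continuous_on S (psi M \<eta>)"
proof -
  interpret prob_space M by fact
  interpret D: real_distribution "distr M borel \<eta>"
    using assms(2) by (rule real_distribution_distr)
  show ?thesis
    unfolding psi_def using D.isCont_char by (intro continuous_intros) 
      (simp add: continuous_at_imp_continuous_on)
qed

text \<open>Pointwise, \<open>4 (1 - cos u) - (1 - cos 2u)\<close> is the nonnegative \<open>2 (1 - cos u)\<^sup>2\<close>.\<close>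

lemma psi_double:
  fixes \<eta> :: "'a \<Rightarrow> real"
  assumes "prob_space M" "\<eta> \<in> borel_measurable M"
  shows "psi M \<eta> (2 * t) \<le> 4 * psi M \<eta> t"
proof -
  have *: "1 - cos (2 * u) \<le> 4 * (1 - cos u)" for u :: real
  proof -
    have "4 * (1 - cos u) - (1 - cos (2 * u)) = 2 * (1 - cos u)\<^sup>2"
      by (simp add: cos_double_cos power2_eq_square right_diff_distrib left_diff_distrib)
    then show ?thesis
      by (smt (verit) zero_le_power2)
  qed
  have "psi M \<eta> (2 * t) \<le> (LINT \<omega>|M. 4 * (1 - cos (t * \<eta> \<omega>)))"
    unfolding psi_eq_integral[OF assms]
    by (intro integral_mono integrable_mult_right integrable_one_minus_cos assms)
      (use * in \<open>simp add: mult.assoc\<close>)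
  then show ?thesis
    by (simp only: psi_eq_integral[OF assms] integral_mult_right_zero)
qed

lemma psi_power_two:
  fixes \<eta> :: "'a \<Rightarrow> real"
  assumes "prob_space M" "\<eta> \<in> borel_measurable M"
  shows "psi M \<eta> (2 ^ m * t) \<le> 4 ^ m * psi M \<eta> t"
proof (induction m)
  case (Suc m)
  have "psi M \<eta> (2 ^ Suc m * t) \<le> 4 * psi M \<eta> (2 ^ m * t)"
    using psi_double[OF assms, of "2 ^ m * t"] by (simp add: mult.assoc)
  with Suc show ?case by simp
qed simp

section \<open>Comparison of tails through \<open>\<psi>\<close>\<close>

lemma set_integrable_psi:
  fixes \<eta> :: "'a \<Rightarrow> real"
  assumes "prob_space M" "\<eta> \<in> borel_measurable M"
  shows "set_integrable lborel {u..v} (\<lambda>t. psi M \<eta> (c * t))"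
  by (intro borel_integrable_atLeastAtMost' continuous_on_compose2[OF continuous_psi[OF assms, of UNIV]]
      continuous_intros) auto

text \<open>
  A dilation by a factor at most \<open>1\<close> shrinks the interval of integration, which is harmless
  for the nonnegative \<open>\<psi>\<close>; a larger factor is first brought below \<open>1\<close> by doublings.
\<close>

lemma integral_psi_dilate_le:
  fixes \<eta> :: "'a \<Rightarrow> real"
  assumes "prob_space M" "\<eta> \<in> borel_measurable M" and c: "0 < c"
  shows "\<exists>K>0. \<forall>a>0. (LBINT t:{-a..a}. psi M \<eta> (c * t)) \<le> K * (LBINT t:{-a..a}. psi M \<eta> t)"
proof -
  note P = assms(1,2)
  obtain m where m: "c < 2 ^ m"
    using real_arch_pow[of 2 c] by auto
  define d where "d = c / 2 ^ m"
  have d: "0 < d" "d \<le> 1" "c = 2 ^ m * d"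
    using c m by (auto simp: d_def)
  have "(LBINT t:{-a..a}. psi M \<eta> (c * t)) \<le> (4 ^ m / d) * (LBINT t:{-a..a}. psi M \<eta> t)"
    if a: "a > 0" for a
  proof -
    have ind: "indicator {-a..a} t = (indicator {-(d*a)..d*a} (0 + d * t) :: real)" for t
      using mult_le_cancel_left_pos[OF d(1), of "-a" t] mult_le_cancel_left_pos[OF d(1), of t a]
      by (simp add: indicator_def)
    have "(LBINT t:{-a..a}. psi M \<eta> (c * t)) \<le> (LBINT t:{-a..a}. 4 ^ m * psi M \<eta> (d * t))"
      by (intro set_integral_mono set_integrable_mult_right set_integrable_psi P)
        (use psi_power_two[OF P, of m] in \<open>simp add: d(3) mult.assoc\<close>)
    also have "\<dots> = 4 ^ m * (LBINT t:{-a..a}. psi M \<eta> (d * t))"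
      by simp
    also have "(LBINT t:{-a..a}. psi M \<eta> (d * t)) =
        (LINT t|lborel. indicator {-(d*a)..d*a} (0 + d * t) *\<^sub>R psi M \<eta> (0 + d * t))"
      unfolding set_lebesgue_integral_def ind by simp
    also have "\<dots> = (1 / d) * (LBINT t:{-(d*a)..d*a}. psi M \<eta> t)"
      unfolding set_lebesgue_integral_def
      using d(1) lborel_integral_real_affine[of d "\<lambda>s. indicator {-(d*a)..d*a} s *\<^sub>R psi M \<eta> s" 0]
      by simp
    also have "(LBINT t:{-(d*a)..d*a}. psi M \<eta> t) \<le> (LBINT t:{-a..a}. psi M \<eta> t)"
      unfolding set_lebesgue_integral_def
    proof (rule integral_mono)
      have "integrable lborel (\<lambda>t. indicator {-s..s} t *\<^sub>R psi M \<eta> t)" for s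
        using set_integrable_psi[OF P, of "-s" s 1] by (simp add: set_integrable_def)
      then show "integrable lborel (\<lambda>t. indicator {-(d*a)..d*a} t *\<^sub>R psi M \<eta> t)"
        and "integrable lborel (\<lambda>t. indicator {-a..a} t *\<^sub>R psi M \<eta> t)"
        by blast+
      have "d * a \<le> a" using mult_right_mono[OF d(2), of a] a by simp
      then show "indicator {-(d*a)..d*a} t *\<^sub>R psi M \<eta> t \<le> indicator {-a..a} t *\<^sub>R psi M \<eta> t" for t
        using psi_nonneg[OF P, of t] by (auto simp: indicator_def)
    qed
    finally show ?thesis
      using d(1) by (simp add: mult_left_mono divide_right_mono)
  qed
  moreover have "4 ^ m / d > 0" using d by simp
  ultimately show ?thesis by blast
qed

text \<open>
  The truncation inequality. The average of \<open>1 - cos (ty)\<close> over \<open>\<bar>t\<bar> \<le> a\<close> is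
  \<open>1 - sin (ay) / (ay)\<close>, which is nonnegative and, once \<open>\<bar>ay\<bar> \<ge> 2\<close>, at least \<open>1 / 2\<close>. Taking
  expectations and exchanging the integrals gives the claim.
\<close>

lemma tail_le_integral_psi:
  fixes \<eta> :: "'a \<Rightarrow> real"
  assumes "prob_space M" and [measurable]: "\<eta> \<in> borel_measurable M" and a: "0 < a"
  shows "tail_fun M \<eta> (2 / a) \<le> inverse a * (LBINT t:{-a..a}. psi M \<eta> t)"
proof -
  interpret prob_space M by fact
  interpret pair_sigma_finite M lborel ..
  let ?A = "{\<omega> \<in> space M. \<bar>\<eta> \<omega>\<bar> \<ge> 2 / a}"
  let ?g = "\<lambda>\<omega> t. indicator {-a..a} t *\<^sub>R (1 - cos (t * \<eta> \<omega>))"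
  have int: "integrable (M \<Otimes>\<^sub>M lborel) (\<lambda>(\<omega>, t). ?g \<omega> t)"
  proof (rule Bochner_Integration.integrable_bound)
    have "emeasure (M \<Otimes>\<^sub>M lborel) (space M \<times> {-a..a}) < \<infinity>"
      by (subst lborel.emeasure_pair_measure_Times) (auto simp: emeasure_space_1 emeasure_lborel_Icc_eq)
    then show "integrable (M \<Otimes>\<^sub>M lborel) (\<lambda>z. 2 * indicator (space M \<times> {-a..a}) z :: real)"
      by (intro integrable_mult_right integrable_real_indicator) auto
    have "\<bar>1 - cos u\<bar> \<le> 2" for u :: real
      using cos_ge_minus_one[of u] cos_le_one[of u] by linarith
    then show "AE z in M \<Otimes>\<^sub>M lborel. norm (case z of (\<omega>, t) \<Rightarrow> ?g \<omega> t)
        \<le> norm (2 * indicator (space M \<times> {-a..a}) z :: real)"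
      by (intro AE_I2) (auto simp: space_pair_measure indicator_times abs_mult split: split_indicator)
  qed measurable
  have inner: "(LBINT t. ?g \<omega> t) \<ge> a * indicator ?A \<omega>" if "\<omega> \<in> space M" for \<omega>
  proof (cases "\<bar>\<eta> \<omega>\<bar> \<ge> 2 / a")
    case True
    define y where "y = \<eta> \<omega>"
    have y: "y \<noteq> 0" "2 \<le> a * \<bar>y\<bar>" using True a by (auto simp: y_def field_simps)
    let ?F = "\<lambda>t. t - sin (t * y) / y"
    have "(LBINT t. (1 - cos (t * y)) * indicator {-a..a} t) = ?F a - ?F (-a)"
      using a y by (intro integral_FTC_Icc_real) (auto intro!: derivative_eq_intros continuous_intros)
    then have "(LBINT t. ?g \<omega> t) = 2 * a - 2 * (sin (a * y) / y)"
      by (simp add: y_def mult.commute)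
    moreover have "sin (a * y) / y \<le> a / 2"
    proof -
      have "sin (a * y) / y \<le> \<bar>sin (a * y)\<bar> / \<bar>y\<bar>"
        by (metis abs_divide abs_ge_self)
      also have "\<dots> \<le> 1 / \<bar>y\<bar>" by (intro divide_right_mono) auto
      also have "\<dots> \<le> a / 2" using y by (simp add: field_simps)
      finally show ?thesis .
    qed
    moreover have "a * indicator ?A \<omega> \<le> a" using a by (simp add: indicator_def)
    ultimately show ?thesis by linarith
  qed (auto intro!: Bochner_Integration.integral_nonneg)
  have "a * tail_fun M \<eta> (2 / a) = (LINT \<omega>|M. a * indicator ?A \<omega>)"
    by (simp add: tail_fun_def)
  also have "\<dots> \<le> (LINT \<omega>|M. (LBINT t. ?g \<omega> t))"
    using integrable_fst[OF int] inner
    by (intro integral_mono) (auto intro!: integrable_mult_right integrable_real_indicator simp: less_top[symmetric])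
  also have "\<dots> = (LBINT t. (LINT \<omega>|M. ?g \<omega> t))"
    using Fubini_integral[OF int] by simp
  also have "\<dots> = (LBINT t:{-a..a}. psi M \<eta> t)"
    unfolding set_lebesgue_integral_def by (simp add: psi_eq_integral[OF assms(1,2)])
  finally show ?thesis using a by (simp add: field_simps)
qed

text \<open>
  The truncation inequality for \<open>\<eta>\<close>, followed by the class \<open>RT\<close>, which says that it is sharp
  for \<open>\<xi>\<close>. The quantifier over \<open>\<eta>\<close> stands inside the one over \<open>x\<close> so that a single threshold
  serves all normed sums with the same bound on \<open>\<psi>\<close>.
\<close>

lemma tail_le_if_psi_le:
  fixes \<xi> :: "'a \<Rightarrow> real"
  assumes P: "prob_space M" "\<xi> \<in> borel_measurable M"
    and RT: "class_RT M \<xi>" and pos: "0 < c" "0 < K" "0 < \<delta>"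
  shows "\<exists>C>0. \<forall>\<^sub>F x in at_top. \<forall>\<eta>\<in>borel_measurable M.
    (\<forall>t. \<bar>t\<bar> < \<delta> \<longrightarrow> psi M \<eta> t \<le> K * psi M \<xi> (c * t)) \<longrightarrow> tail_fun M \<eta> x \<le> C * tail_fun M \<xi> x"
proof -
  obtain C1 where C1: "C1 > 0"
    "\<forall>\<^sub>F a in at_right 0. tail_fun M \<xi> (2 / a) \<ge> C1 * inverse a * (LBINT t:{-a..a}. psi M \<xi> t)"
    using RT unfolding class_RT_def by blast
  obtain D where D: "D > 0"
    "\<And>a. a > 0 \<Longrightarrow> (LBINT t:{-a..a}. psi M \<xi> (c * t)) \<le> D * (LBINT t:{-a..a}. psi M \<xi> t)"
    using integral_psi_dilate_le[OF P pos(1)] by blast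
  have lim: "filterlim (\<lambda>x::real. 2 / x) (at_right 0) at_top"
    by (intro tendsto_imp_filterlim_at_right tendsto_divide_0[OF tendsto_const] filterlim_at_top_imp_at_infinity
        filterlim_ident eventually_mono[OF eventually_gt_at_top[of 0]]) simp
  have ev: "\<forall>\<^sub>F x in at_top. tail_fun M \<xi> (2 / (2 / x)) \<ge> C1 * inverse (2 / x) * (LBINT t:{-(2/x)..2/x}. psi M \<xi> t)"
    using lim C1(2) by (rule eventually_compose_filterlim[rotated])
  have "\<forall>\<^sub>F x in at_top. \<forall>\<eta>\<in>borel_measurable M.
    (\<forall>t. \<bar>t\<bar> < \<delta> \<longrightarrow> psi M \<eta> t \<le> K * psi M \<xi> (c * t)) \<longrightarrow> tail_fun M \<eta> x \<le> (K * D / C1) * tail_fun M \<xi> x"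
    using ev eventually_gt_at_top[of "2 / \<delta>"] eventually_gt_at_top[of "0::real"]
  proof eventually_elim
    case (elim x)
    define a where "a = 2 / x"
    have a: "0 < a" "a < \<delta>" "x = 2 / a" using elim pos by (auto simp: a_def field_simps)
    show ?case
    proof (intro ballI impI)
      fix \<eta> assume \<eta>: "\<eta> \<in> borel_measurable M"
        and le: "\<forall>t. \<bar>t\<bar> < \<delta> \<longrightarrow> psi M \<eta> t \<le> K * psi M \<xi> (c * t)"
      have "tail_fun M \<eta> x \<le> inverse a * (LBINT t:{-a..a}. psi M \<eta> t)"
        unfolding a(3) using tail_le_integral_psi[OF P(1) \<eta> a(1)] .
      also have "\<dots> \<le> inverse a * (LBINT t:{-a..a}. K * psi M \<xi> (c * t))"
      proof (intro mult_left_mono set_integral_mono set_integrable_mult_right set_integrable_psi P)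
        show "set_integrable lborel {-a..a} (psi M \<eta>)"
          using set_integrable_psi[OF P(1) \<eta>, of "-a" a 1] by simp
        show "psi M \<eta> t \<le> K * psi M \<xi> (c * t)" if "t \<in> {-a..a}" for t
          using le that a by auto
      qed (use a in simp)
      also have "\<dots> \<le> inverse a * (K * (D * (LBINT t:{-a..a}. psi M \<xi> t)))"
        using D(2)[OF a(1)] pos a(1) by simp
      also have "\<dots> = (K * D / C1) * (C1 * inverse a * (LBINT t:{-a..a}. psi M \<xi> t))"
        using C1(1) by simp
      also have "\<dots> \<le> (K * D / C1) * tail_fun M \<xi> x"
        using elim(1) pos D(1) C1(1) unfolding a_def[symmetric] a(3)[symmetric]
        by (intro mult_left_mono) auto
      finally show "tail_fun M \<eta> x \<le> (K * D / C1) * tail_fun M \<xi> x" .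
    qed
  qed
  moreover have "K * D / C1 > 0" using pos D C1 by simp
  ultimately show ?thesis by blast
qed

section \<open>Bounds on \<open>\<psi>\<close> of the normed sums\<close>

lemma char_symmetric:
  fixes \<xi> :: "'a \<Rightarrow> real"
  assumes "prob_space M" and [measurable]: "\<xi> \<in> borel_measurable M" and "symmetric_rv M \<xi>"
  shows "char (distr M borel \<xi>) t = complex_of_real (1 - psi M \<xi> t)"
proof -
  have eq: "char (distr M borel \<eta>) t = (CLINT \<omega>|M. iexp (t * \<eta> \<omega>))"
    if [measurable]: "\<eta> \<in> borel_measurable M" for \<eta>
    unfolding char_def by (subst integral_distr) auto
  have "char (distr M borel \<xi>) t = (CLINT \<omega>|M. iexp (t * - \<xi> \<omega>))"
    using assms(3) eq[of "\<lambda>\<omega>. - \<xi> \<omega>"] by (simp add: symmetric_rv_def)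
  also have "\<dots> = (CLINT \<omega>|M. cnj (iexp (t * \<xi> \<omega>)))"
    by (simp add: exp_cnj)
  also have "\<dots> = cnj (char (distr M borel \<xi>) t)"
    by (simp only: eq[OF assms(2)] Bochner_Integration.integral_cnj)
  finally have "Im (char (distr M borel \<xi>) t) = 0"
    by (metis Reals_cnj_iff complex_is_Real_iff)
  then show ?thesis by (simp add: psi_def complex_eq_iff)
qed

text \<open>
  The characteristic function of the sum is a power \<open>z\<^sup>n\<close> with \<open>\<bar>z\<bar> \<le> 1\<close>, so that
  \<open>\<bar>1 - z\<^sup>n\<bar> \<le> n \<bar>1 - z\<bar>\<close>; symmetry is what makes \<open>\<bar>1 - z\<bar>\<close> equal to \<open>\<psi>\<close> rather than merely
  bound it from above.
\<close>

lemma psi_normed_sum_le: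
  fixes \<xi> :: "'a \<Rightarrow> real"
  assumes P: "prob_space M" "\<xi> \<in> borel_measurable M" and sym: "symmetric_rv M \<xi>"
    and iid: "iid_copies M \<xi> X"
  shows "psi M (normed_sum b X n) t \<le> real n * psi M \<xi> (t / b n)"
proof -
  interpret prob_space M by fact
  interpret D: real_distribution "distr M borel \<xi>"
    using P(2) by (rule real_distribution_distr)
  have ind: "indep_vars (\<lambda>_. borel) X {1..n}"
    using iid unfolding iid_copies_def by (auto intro: indep_vars_subset)
  then have X[measurable]: "random_variable borel (X k)" if "k \<in> {1..n}" for k
    using that unfolding indep_vars_def by auto
  have [measurable]: "(\<lambda>\<omega>. \<Sum>k=1..n. X k \<omega>) \<in> borel_measurable M"
    by (intro borel_measurable_sum) (use X in auto)
  let ?u = "t / b n"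
  have "char (distr M borel (normed_sum b X n)) t = char (distr M borel (\<lambda>\<omega>. \<Sum>k=1..n. X k \<omega>)) ?u"
    unfolding char_def normed_sum_def
    by (subst (1 2) integral_distr) (auto simp: divide_inverse mult_ac)
  also have "\<dots> = (\<Prod>k=1..n. char (distr M borel (X k)) ?u)"
    using ind by (rule char_distr_sum)
  also have "\<dots> = (char (distr M borel \<xi>) ?u) ^ n"
    using iid by (simp add: iid_copies_def)
  finally have eq: "psi M (normed_sum b X n) t = 1 - Re ((char (distr M borel \<xi>) ?u) ^ n)"
    by (simp add: psi_def)
  also have "\<dots> \<le> cmod (1 ^ n - (char (distr M borel \<xi>) ?u) ^ n)"
    using complex_Re_le_cmod[of "1 ^ n - (char (distr M borel \<xi>) ?u) ^ n"] by simp
  also have "\<dots> \<le> n * cmod (1 - char (distr M borel \<xi>) ?u)"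
    by (rule norm_power_diff) (auto simp: D.cmod_char_le_1)
  also have "cmod (1 - char (distr M borel \<xi>) ?u) = psi M \<xi> ?u"
    using psi_nonneg[OF P, of ?u] by (simp add: char_symmetric[OF P sym])
  finally show ?thesis .
qed

text \<open>
  If \<open>\<psi>\<close> vanished on \<open>[-a, a]\<close>, the truncation inequality would make the tail at \<open>2 / a\<close> zero.
\<close>

lemma psi_pos_if_tail_pos:
  fixes \<xi> :: "'a \<Rightarrow> real"
  assumes P: "prob_space M" "\<xi> \<in> borel_measurable M" and "0 < a" "0 < tail_fun M \<xi> (2 / a)"
  shows "\<exists>l. 0 < l \<and> l \<le> a \<and> 0 < psi M \<xi> l"
proof (rule ccontr)
  assume "\<not> ?thesis"
  then have *: "psi M \<xi> l = 0" if "0 < l" "l \<le> a" for l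
    using that psi_nonneg[OF P, of l] by (metis less_eq_real_def)
  have "psi M \<xi> t = 0" if "t \<in> {-a..a}" for t
    using that *[of t] *[of "-t"] psi_0[OF P] psi_minus[OF P, of t]
    by (cases t "0::real" rule: linorder_cases) auto
  then have "(LBINT t:{-a..a}. psi M \<xi> t) = (LBINT t:{-a..a}. 0)"
    by (intro set_lebesgue_integral_cong) auto
  then show False
    using tail_le_integral_psi[OF P assms(3)] assms(4) by simp
qed

text \<open>
  The norming sequence is only required to solve its equation when a solution exists. As \<open>\<psi>\<close> is
  continuous and vanishes at \<open>0\<close>, it takes the value \<open>1 / n\<close> on \<open>(0, l]\<close> as soon as
  \<open>1 / n \<le> \<psi>(l)\<close>.
\<close>

lemma eventually_norming_equation:
  fixes \<xi> :: "'a \<Rightarrow> real"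
  assumes P: "prob_space M" "\<xi> \<in> borel_measurable M" and l: "0 < l" "0 < psi M \<xi> l"
    and b: "natural_norming M \<xi> b"
  shows "\<forall>\<^sub>F n in sequentially. real n * psi M \<xi> (1 / b n) = 1"
proof -
  have "\<forall>\<^sub>F n in sequentially. real n \<ge> 1 / psi M \<xi> l"
    using filterlim_real_sequentially by (simp add: filterlim_at_top)
  then show ?thesis
    using eventually_ge_at_top[of "2::nat"]
  proof eventually_elim
    case (elim n)
    have "\<exists>s\<ge>0. s \<le> l \<and> psi M \<xi> s = 1 / real n"
      using elim l psi_0[OF P] by (intro IVT' continuous_psi P) (auto simp: field_simps)
    then obtain s where s: "0 \<le> s" "psi M \<xi> s = 1 / real n" by blast
    then have "s \<noteq> 0" using psi_0[OF P] elim by auto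
    with s elim have "\<exists>c>0. real n * psi M \<xi> (1 / c) = 1"
      by (intro exI[of _ "1 / s"]) auto
    then show ?case using b elim unfolding natural_norming_def by blast
  qed
qed

text \<open>
  The bound must not depend on \<open>n\<close>. Monotonicity of \<open>\<psi>(\<lambda>t) / \<psi>(\<lambda>)\<close> is compared at a fixed
  \<open>l < 1\<close> rather than in the limit \<open>\<lambda> \<rightarrow> 1\<close>, since \<open>\<psi>(1)\<close> may vanish (when \<open>\<xi>\<close> takes values in
  \<open>2\<pi>\<int>\<close>). Divergence of \<open>b\<close> brings \<open>1 / b n\<close> below \<open>l\<close>.
\<close>

lemma eventually_psi_normed_sum_le:
  fixes \<xi> :: "'a \<Rightarrow> real"
  assumes P: "prob_space M" "\<xi> \<in> borel_measurable M" and sym: "symmetric_rv M \<xi>"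
    and MD: "class_MD M \<xi>" and iid: "iid_copies M \<xi> X" and b: "natural_norming M \<xi> b"
    and l: "0 < l" "l < 1" "0 < psi M \<xi> l"
  shows "\<exists>\<delta>>0. \<forall>\<^sub>F n in sequentially. \<forall>t. \<bar>t\<bar> < \<delta> \<longrightarrow>
    psi M (normed_sum b X n) t \<le> (1 / psi M \<xi> l) * psi M \<xi> (l * t)"
proof -
  obtain \<delta> where \<delta>: "\<delta> > 0"
    "\<And>t. 0 \<le> t \<Longrightarrow> t < \<delta> \<Longrightarrow> mono_on {0<..<1} (\<lambda>l. psi M \<xi> (l * t) / psi M \<xi> l)"
    using MD unfolding class_MD_def by (meson atLeastLessThan_iff)
  have "filterlim b at_top sequentially"
    using b by (simp add: natural_norming_def)
  then have "\<forall>\<^sub>F n in sequentially. b n \<ge> 1 / l"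
    by (simp add: filterlim_at_top)
  then have "\<forall>\<^sub>F n in sequentially. \<forall>t. \<bar>t\<bar> < \<delta> \<longrightarrow>
    psi M (normed_sum b X n) t \<le> (1 / psi M \<xi> l) * psi M \<xi> (l * t)"
    using eventually_norming_equation[OF P l(1,3) b]
  proof eventually_elim
    case (elim n)
    have "0 < 1 / l" using l by simp
    with elim(1) have bn: "0 < b n" by linarith
    then have lam: "0 < 1 / b n" "1 / b n \<le> l"
      using elim(1) l by (auto simp: field_simps)
    have "1 / psi M \<xi> (1 / b n) = real n"
      using elim(2) by (auto simp: divide_eq_eq)
    show ?case
    proof (intro allI impI)
      fix t assume t: "\<bar>t\<bar> < \<delta>"
      have even: "psi M \<xi> (s * \<bar>t\<bar>) = psi M \<xi> (s * t)" for s
        using psi_minus[OF P, of "s * t"] by (cases "t \<ge> 0") auto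
      have "psi M (normed_sum b X n) t \<le> real n * psi M \<xi> (t / b n)"
        by (rule psi_normed_sum_le[OF P sym iid])
      also have "\<dots> = psi M \<xi> (1 / b n * \<bar>t\<bar>) / psi M \<xi> (1 / b n)"
        unfolding even \<open>1 / psi M \<xi> (1 / b n) = real n\<close>[symmetric] by simp
      also have "\<dots> \<le> psi M \<xi> (l * \<bar>t\<bar>) / psi M \<xi> l"
        using t lam order.strict_trans1[OF lam(2) l(2)] l by (intro mono_onD[OF \<delta>(2)]) auto
      finally show "psi M (normed_sum b X n) t \<le> (1 / psi M \<xi> l) * psi M \<xi> (l * t)"
        unfolding even by simp
    qed
  qed
  with \<delta>(1) show ?thesis by blast
qed

section \<open>Comparison of the supremum of the tails with the tail of \<open>\<xi>\<close>\<close>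

lemma measurable_normed_sum:
  assumes P: "prob_space M" and iid: "iid_copies M \<xi> X"
  shows "normed_sum b X n \<in> borel_measurable M"
proof -
  interpret prob_space M by fact
  have "X k \<in> borel_measurable M" if "k \<in> {1..n}" for k
    using iid that unfolding iid_copies_def indep_vars_def by auto
  then have "(\<lambda>\<omega>. \<Sum>k=1..n. X k \<omega>) \<in> borel_measurable M"
    by (intro borel_measurable_sum)
  then show ?thesis unfolding normed_sum_def[abs_def] by measurable
qed

lemma tail_fun_cong_distr:
  fixes \<eta> \<zeta> :: "'a \<Rightarrow> real"
  assumes [measurable]: "\<eta> \<in> borel_measurable M" "\<zeta> \<in> borel_measurable M"
    and "distr M borel \<eta> = distr M borel \<zeta>"
  shows "tail_fun M \<eta> x = tail_fun M \<zeta> x"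
proof -
  have "tail_fun M \<theta> x = measure (distr M borel \<theta>) {y. \<bar>y\<bar> \<ge> x}"
    if [measurable]: "\<theta> \<in> borel_measurable M" for \<theta>
    unfolding tail_fun_def
    by (subst measure_distr) (auto intro!: arg_cong[where f = "measure M"])
  then show ?thesis using assms by simp
qed

lemma sup_tail_le:
  assumes "\<And>n. n \<ge> 1 \<Longrightarrow> tail_fun M (normed_sum b X n) x \<le> B"
  shows "sup_tail M b X x \<le> B"
  unfolding sup_tail_def using assms by (intro cSUP_least) auto

lemma tail_le_sup_tail:
  fixes \<xi> :: "'a \<Rightarrow> real"
  assumes P: "prob_space M" "\<xi> \<in> borel_measurable M"
    and iid: "iid_copies M \<xi> X" and b: "natural_norming M \<xi> b"
  shows "tail_fun M \<xi> x \<le> sup_tail M b X x"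
proof -
  interpret prob_space M by fact
  have X1: "X 1 \<in> borel_measurable M" "distr M borel (X 1) = distr M borel \<xi>"
    using iid unfolding iid_copies_def indep_vars_def by auto
  have "normed_sum b X 1 = X 1"
    using b by (simp add: normed_sum_def[abs_def] natural_norming_def)
  then have "tail_fun M \<xi> x = tail_fun M (normed_sum b X 1) x"
    using tail_fun_cong_distr[OF X1(1) P(2) X1(2)] by simp
  also have "\<dots> \<le> sup_tail M b X x"
    unfolding sup_tail_def
    by (rule cSUP_upper) (auto intro!: bdd_aboveI[of _ 1] simp: tail_fun_def)
  finally show ?thesis .
qed

theorem theorem2p3:
  fixes M :: "'a measure" and \<xi> :: "'a \<Rightarrow> real" and X :: "nat \<Rightarrow> 'a \<Rightarrow> real"
    and b :: "nat \<Rightarrow> real" and L :: "real \<Rightarrow> real" and r \<gamma> :: real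
  assumes "prob_space M"
    and "\<xi> \<in> borel_measurable M"
    and "symmetric_rv M \<xi>"
    and "0 < r" and "r < 2"
    and "continuous_on {1<..} L" and "\<And>y. y > 1 \<Longrightarrow> L y > 0" and "slowly_varying L"
    and "\<And>x. x > exp 1 \<Longrightarrow>
           tail_fun M \<xi> x = x powr (- r) * (ln x) powr \<gamma> * L (ln x)"
    and "class_RT M \<xi>" and "class_MD M \<xi>"
    and "iid_copies M \<xi> X"
    and "natural_norming M \<xi> b"
  shows "\<exists>C>0. \<exists>x0>1. \<forall>x>x0.
           tail_fun M \<xi> x \<le> sup_tail M b X x \<and>
           sup_tail M b X x \<le> C * tail_fun M \<xi> x"
proof -
  note P = assms(1,2)
  note sym = assms(3) and RT = assms(10) and MD = assms(11) and iid = assms(12) and b = assms(13)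
  let ?T = "tail_fun M \<xi>" and ?TS = "\<lambda>n. tail_fun M (normed_sum b X n)"
  \<comment> \<open>The point \<open>8 = 2 / (1 / 4)\<close> lies beyond \<open>e\<close>, where the tail formula makes the tail positive;
    this provides an \<open>l \<le> 1 / 4\<close> with \<open>\<psi>(l) > 0\<close>.\<close>
  have "2 / (1 / 4) > exp (1::real)" using e_less_272 by simp
  moreover from this have "ln (2 / (1 / 4)) > (1::real)"
    by (metis exp_gt_zero ln_exp ln_less_cancel_iff order.strict_trans)
  ultimately have "0 < ?T (2 / (1 / 4))"
    using assms(7,9) by (simp del: divide_divide_eq_right)
  from psi_pos_if_tail_pos[OF P _ this] obtain l where l: "0 < l" "l < 1" "0 < psi M \<xi> l"
    by auto
  obtain \<delta> where \<delta>: "\<delta> > 0" "\<forall>\<^sub>F n in sequentially. \<forall>t. \<bar>t\<bar> < \<delta> \<longrightarrow>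
      psi M (normed_sum b X n) t \<le> (1 / psi M \<xi> l) * psi M \<xi> (l * t)"
    using eventually_psi_normed_sum_le[OF P sym MD iid b l] by blast
  then obtain N where N: "\<And>n t. n \<ge> N \<Longrightarrow> \<bar>t\<bar> < \<delta> \<Longrightarrow>
      psi M (normed_sum b X n) t \<le> (1 / psi M \<xi> l) * psi M \<xi> (l * t)"
    unfolding eventually_sequentially by blast
  have "0 < 1 / psi M \<xi> l" using l by simp
  from tail_le_if_psi_le[OF P RT l(1) this \<delta>(1)] obtain C where C: "C > 0"
    "\<forall>\<^sub>F x in at_top. \<forall>\<eta>\<in>borel_measurable M. (\<forall>t. \<bar>t\<bar> < \<delta> \<longrightarrow>
       psi M \<eta> t \<le> (1 / psi M \<xi> l) * psi M \<xi> (l * t)) \<longrightarrow> tail_fun M \<eta> x \<le> C * ?T x"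
    by blast
  from C(2) have large: "\<forall>\<^sub>F x in at_top. \<forall>n\<ge>N. ?TS n x \<le> C * ?T x"
    by eventually_elim (use N measurable_normed_sum[OF P(1) iid] in blast)
  \<comment> \<open>A constant for each single \<open>n\<close>, not uniform in \<open>n\<close>; it is used only for \<open>n < N\<close>, where the
    norming equation may fail.\<close>
  have "\<exists>C>0. \<forall>\<^sub>F x in at_top. ?TS n x \<le> C * ?T x" if "n \<ge> 1" for n
  proof -
    have bn: "0 < 1 / b n" "0 < real n"
      using b that unfolding natural_norming_def by (cases "n = 1"; force)+
    obtain C where C': "C > 0" "\<forall>\<^sub>F x in at_top. \<forall>\<eta>\<in>borel_measurable M. (\<forall>t. \<bar>t\<bar> < 1 \<longrightarrow>
        psi M \<eta> t \<le> real n * psi M \<xi> (1 / b n * t)) \<longrightarrow> tail_fun M \<eta> x \<le> C * ?T x"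
      using tail_le_if_psi_le[OF P RT bn zero_less_one] by blast
    from C'(2) have "\<forall>\<^sub>F x in at_top. ?TS n x \<le> C * ?T x"
      by eventually_elim (use psi_normed_sum_le[OF P sym iid, of b n]
          measurable_normed_sum[OF P(1) iid] in simp)
    with C'(1) show ?thesis by blast
  qed
  then obtain K where K: "\<And>n. n \<ge> 1 \<Longrightarrow> K n > 0"
    "\<And>n. n \<ge> 1 \<Longrightarrow> \<forall>\<^sub>F x in at_top. ?TS n x \<le> K n * ?T x"
    by metis
  define B where "B = C + (\<Sum>n\<in>{1..<N}. K n)"
  have sum_nn: "0 \<le> (\<Sum>n\<in>{1..<N}. K n)" using K(1) by (intro sum_nonneg) (simp add: less_imp_le)
  have Kle: "K n \<le> B" if "n \<in> {1..<N}" for n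
  proof -
    have "K n \<le> (\<Sum>n\<in>{1..<N}. K n)"
      using that K(1) by (intro member_le_sum) (auto simp: less_imp_le)
    then show ?thesis using C(1) by (simp add: B_def)
  qed
  have B: "B > 0" "C \<le> B" using C(1) sum_nn by (auto simp: B_def)
  have small: "\<forall>\<^sub>F x in at_top. \<forall>n\<in>{1..<N}. ?TS n x \<le> K n * ?T x"
    using K(2) by (intro eventually_ball_finite) auto
  have Tnn: "0 \<le> ?T x" for x by (simp add: tail_fun_def)
  have "\<forall>\<^sub>F x in at_top. sup_tail M b X x \<le> B * ?T x"
    using large small
  proof eventually_elim
    case (elim x)
    show ?case
    proof (rule sup_tail_le)
      fix n :: nat assume "n \<ge> 1"
      show "?TS n x \<le> B * ?T x"
      proof (cases "n \<ge> N")
        case True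
        then have "?TS n x \<le> C * ?T x" using elim by blast
        also have "\<dots> \<le> B * ?T x" using B Tnn by (intro mult_right_mono) auto
        finally show ?thesis .
      next
        case False
        then have n: "n \<in> {1..<N}" using \<open>n \<ge> 1\<close> by simp
        then have "?TS n x \<le> K n * ?T x" using elim by blast
        also have "\<dots> \<le> B * ?T x" using Kle[OF n] Tnn by (intro mult_right_mono) auto
        finally show ?thesis .
      qed
    qed
  qed
  then obtain x1 where x1: "\<And>x. x \<ge> x1 \<Longrightarrow> sup_tail M b X x \<le> B * ?T x"
    unfolding eventually_at_top_linorder by blast
  show ?thesis
  proof (intro exI conjI allI impI)
    show "B > 0" by (fact B(1))
    show "max 2 x1 > 1" by simp
    show "?T x \<le> sup_tail M b X x" for x by (fact tail_le_sup_tail[OF P iid b])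
    show "sup_tail M b X x \<le> B * ?T x" if "max 2 x1 < x" for x
      using that by (intro x1) simp
  qed
qed

end
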